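(* Let $(\mathfrak g,\pi,\omega)$ be a Lie-Yamaguti algebra over a field $\mathbb K$ of characteristic $0$ (binary bracket $\pi=[\cdot,\cdot]$, ternary bracket $\omega=[\![\cdot,\cdot,\cdot]\!]$), put $\Pi=(\pi,\omega)\in\mathfrak C^1(\mathfrak g,\mathfrak g)$ and $d_\Pi=[\Pi,\cdot]_{\mathsf{LieY}}$, and let $\delta:\mathfrak C^n(\mathfrak g,\mathfrak g)\to\mathfrak C^{n+1}(\mathfrak g,\mathfrak g)$ ($n\ge0$) be the Yamaguti coboundary map associated to the adjoint representation. Then $$\delta(F)=(-1)^n d_\Pi(F)=(-1)^n[\Pi,F]_{\mathsf{LieY}}\quad\text{for all }F\in\mathfrak C^n(\mathfrak g,\mathfrak g),\ n\ge1,$$ $$\delta(f)=d_\Pi(f)=[\Pi,f]_{\mathsf{LieY}}\quad\text{for all }f\in\mathfrak C^0(\mathfrak g,\mathfrak g)=\mathrm{Hom}(\mathfrak g,\mathfrak g).$$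
   Context: Lie-Yamaguti algebra: a vector space $\mathfrak g$ with a bilinear bracket $[\cdot,\cdot]:\wedge^2\mathfrak g\to\mathfrak g$ and a trilinear bracket $[\![\cdot,\cdot,\cdot]\!]:\wedge^2\mathfrak g\otimes\mathfrak g\to\mathfrak g$ such that for all $x,y,z,w,t\in\mathfrak g$: (1) $[[x,y],z]+[[y,z],x]+[[z,x],y]+[\![x,y,z]\!]+[\![y,z,x]\!]+[\![z,x,y]\!]=0$; (2) $[\![[x,y],z,w]\!]+[\![[y,z],x,w]\!]+[\![[z,x],y,w]\!]=0$; (3) $[\![x,y,[z,w]]\!]=[[\![x,y,z]\!],w]+[z,[\![x,y,w]\!]]$; (4) $[\![x,y,[\![z,w,t]\!]]\!]=[\![[\![x,y,z]\!],w,t]\!]+[\![z,[\![x,y,w]\!],t]\!]+[\![z,w,[\![x,y,t]\!]]\!]$. Shuffles: $\mathbb S_{(i,n-i)}$ is the set of $\sigma\in S_n$ with $\sigma(1)<\cdots<\sigma(i)$ and $\sigma(i+1)<\cdots<\sigma(n)$ (only the identity if $i=0$ or $i=n$). The graded space: $\mathfrak C^0(\mathfrak g,\mathfrak g)=\mathrm{Hom}(\mathfrak g,\mathfrak g)$ and, for $p\ge1$, $\mathfrak C^p(\mathfrak g,\mathfrak g)=\mathrm{Hom}((\wedge^2\mathfrak g)^{\otimes p},\mathfrak g)\oplus\mathrm{Hom}((\wedge^2\mathfrak g)^{\otimes p}\otimes\mathfrak g,\mathfrak g)$, in degree $p$; elements are written $P=(P_{\rm I},P_{\rm II})$. The operation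 $\circ$: below $\mathfrak X_i=x_i\wedge y_i\in\wedge^2\mathfrak g$ and $x\in\mathfrak g$. For $P\in\mathfrak C^p$, $Q\in\mathfrak C^q$ with $p,q\ge1$, $P\circ Q\in\mathfrak C^{p+q}$ is given by $$(P\circ Q)_{\rm I}(\mathfrak X_1,\dots,\mathfrak X_{p+q})=\sum_{\sigma\in\mathbb S_{(p,q)},\,\sigma(p+q)=p+q}(-1)^{pq}\mathrm{sign}(\sigma)P_{\rm II}(\mathfrak X_{\sigma(1)},\dots,\mathfrak X_{\sigma(p)},Q_{\rm I}(\mathfrak X_{\sigma(p+1)},\dots,\mathfrak X_{\sigma(p+q)}))$$ $$+\sum_{k=1}^p(-1)^{(k-1)q}\sum_{\sigma\in\mathbb S_{(k-1,q)}}\mathrm{sign}(\sigma)P_{\rm I}(\mathfrak X_{\sigma(1)},\dots,\mathfrak X_{\sigma(k-1)},x_{k+q}\wedge Q_{\rm II}(\mathfrak X_{\sigma(k)},\dots,\mathfrak X_{\sigma(k+q-1)},y_{k+q}),\mathfrak X_{k+q+1},\dots,\mathfrak X_{p+q})$$ $$+\sum_{k=1}^p(-1)^{(k-1)q}\sum_{\sigma\in\mathbb S_{(k-1,q)}}\mathrm{sign}(\sigma)P_{\rm I}(\mathfrak X_{\sigma(1)},\dots,\mathfrak X_{\sigma(k-1)},Q_{\rm II}(\mathfrak X_{\sigma(k)},\dots,\mathfrak X_{\sigma(k+q-1)},x_{k+q})\wedge y_{k+q},\mathfrak X_{k+q+1},\dots,\mathfrak X_{p+q}),$$ and $$(P\circ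 Q)_{\rm II}(\mathfrak X_1,\dots,\mathfrak X_{p+q},x)=\sum_{\sigma\in\mathbb S_{(p,q)}}(-1)^{pq}\mathrm{sign}(\sigma)P_{\rm II}(\mathfrak X_{\sigma(1)},\dots,\mathfrak X_{\sigma(p)},Q_{\rm II}(\mathfrak X_{\sigma(p+1)},\dots,\mathfrak X_{\sigma(p+q)},x))$$ $$+\sum_{k=1}^p(-1)^{(k-1)q}\sum_{\sigma\in\mathbb S_{(k-1,q)}}\mathrm{sign}(\sigma)P_{\rm II}(\mathfrak X_{\sigma(1)},\dots,\mathfrak X_{\sigma(k-1)},x_{k+q}\wedge Q_{\rm II}(\mathfrak X_{\sigma(k)},\dots,\mathfrak X_{\sigma(k+q-1)},y_{k+q}),\mathfrak X_{k+q+1},\dots,\mathfrak X_{p+q},x)$$ $$+\sum_{k=1}^p(-1)^{(k-1)q}\sum_{\sigma\in\mathbb S_{(k-1,q)}}\mathrm{sign}(\sigma)P_{\rm II}(\mathfrak X_{\sigma(1)},\dots,\mathfrak X_{\sigma(k-1)},Q_{\rm II}(\mathfrak X_{\sigma(k)},\dots,\mathfrak X_{\sigma(k+q-1)},x_{k+q})\wedge y_{k+q},\mathfrak X_{k+q+1},\dots,\mathfrak X_{p+q},x).$$ For $f,g\in\mathfrak C^0$ and $P\in\mathfrak C^p$ ($p\ge1$): $f\circ g$ is composition; $(f\circ P)_{\rm I}=f\circ P_{\rm I}$, $(f\circ P)_{\rm II}=f\circ P_{\rm II}$ (compositions); $(P\circ f)_{\rm I}(\mathfrak X_1,\dots,\mathfrak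 X_p)=\sum_{k=1}^pP_{\rm I}(\mathfrak X_1,\dots,\mathfrak X_{k-1},x_k\wedge f(y_k)+f(x_k)\wedge y_k,\mathfrak X_{k+1},\dots,\mathfrak X_p)$; $(P\circ f)_{\rm II}(\mathfrak X_1,\dots,\mathfrak X_p,x)=\sum_{k=1}^pP_{\rm II}(\mathfrak X_1,\dots,\mathfrak X_{k-1},x_k\wedge f(y_k)+f(x_k)\wedge y_k,\mathfrak X_{k+1},\dots,\mathfrak X_p,x)+P_{\rm II}(\mathfrak X_1,\dots,\mathfrak X_p,f(x))$. The graded Lie bracket is $[P,Q]_{\mathsf{LieY}}=P\circ Q-(-1)^{pq}Q\circ P$ for $P\in\mathfrak C^p$, $Q\in\mathfrak C^q$. Yamaguti coboundary for the adjoint representation. The adjoint representation of $\mathfrak g$ on itself is $\rho(x)z=[x,z]$, $\mu(x,y)z=[\![z,x,y]\!]$, with $D(x,y)z=[\![x,y,z]\!]$. The space of Yamaguti $(n+1)$-cochains with values in $\mathfrak g$ is $\mathfrak C^n(\mathfrak g,\mathfrak g)$. Write $\mathfrak X_k\circ\mathfrak X_l=[\![x_k,y_k,x_l]\!]\wedge y_l+x_l\wedge[\![x_k,y_k,y_l]\!]$ and let a hat denote omission. For $n\ge1$ and $F=(f,g)\in\mathfrak C^n(\mathfrak g,\mathfrak g)$, $\delta F=(\delta_{\rm I}F,\delta_{\rm II}F)$ with $$\delta_{\rm I}F(\mathfrak X_1,\dots,\mathfrak X_{n+1})=(-1)^n\big(\rho(x_{n+1})g(\mathfrak X_1,\dots,\mathfrak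 X_n,y_{n+1})-\rho(y_{n+1})g(\mathfrak X_1,\dots,\mathfrak X_n,x_{n+1})-g(\mathfrak X_1,\dots,\mathfrak X_n,[x_{n+1},y_{n+1}])\big)$$ $$+\sum_{k=1}^n(-1)^{k+1}D(\mathfrak X_k)f(\mathfrak X_1,\dots,\hat{\mathfrak X}_k,\dots,\mathfrak X_{n+1})+\sum_{1\le k<l\le n+1}(-1)^kf(\mathfrak X_1,\dots,\hat{\mathfrak X}_k,\dots,\mathfrak X_k\circ\mathfrak X_l,\dots,\mathfrak X_{n+1}),$$ $$\delta_{\rm II}F(\mathfrak X_1,\dots,\mathfrak X_{n+1},z)=(-1)^n\big(\mu(y_{n+1},z)g(\mathfrak X_1,\dots,\mathfrak X_n,x_{n+1})-\mu(x_{n+1},z)g(\mathfrak X_1,\dots,\mathfrak X_n,y_{n+1})\big)$$ $$+\sum_{k=1}^{n+1}(-1)^{k+1}D(\mathfrak X_k)g(\mathfrak X_1,\dots,\hat{\mathfrak X}_k,\dots,\mathfrak X_{n+1},z)+\sum_{1\le k<l\le n+1}(-1)^kg(\mathfrak X_1,\dots,\hat{\mathfrak X}_k,\dots,\mathfrak X_k\circ\mathfrak X_l,\dots,\mathfrak X_{n+1},z)$$ $$+\sum_{k=1}^{n+1}(-1)^kg(\mathfrak X_1,\dots,\hat{\mathfrak X}_k,\dots,\mathfrak X_{n+1},[\![x_k,y_k,z]\!]).$$ For $f\in\mathrm{Hom}(\mathfrak g,\mathfrak g)$: $\delta_{\rm I}f(x,y)=\rho(x)f(y)-\rho(y)f(x)-f([x,y])$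 and $\delta_{\rm II}f(x,y,z)=D(x,y)f(z)+\mu(y,z)f(x)-\mu(x,z)f(y)-f([\![x,y,z]\!])$. *)

theory Defs
  imports
    Complex_Main
    "HOL-Combinatorics.Permutations"
    "HOL-Library.Function_Algebras"
    "HOL-Library.Product_Plus"
begin

locale lie_yamaguti_algebra = vector_space scale
  for scale :: "'k::field \<Rightarrow> 'g::ab_group_add \<Rightarrow> 'g" (infixr "*s" 75) +
  fixes br :: "'g \<Rightarrow> 'g \<Rightarrow> 'g"
    and tri :: "'g \<Rightarrow> 'g \<Rightarrow> 'g \<Rightarrow> 'g"
  assumes br_linear1: "Vector_Spaces.linear scale scale (\<lambda>x. br x y)"
    and br_linear2: "Vector_Spaces.linear scale scale (\<lambda>y. br x y)"
    and br_alt: "br x x = 0"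
    and tri_linear1: "Vector_Spaces.linear scale scale (\<lambda>x. tri x y z)"
    and tri_linear2: "Vector_Spaces.linear scale scale (\<lambda>y. tri x y z)"
    and tri_linear3: "Vector_Spaces.linear scale scale (\<lambda>z. tri x y z)"
    and tri_alt: "tri x x z = 0"
    and LY1: "br (br x y) z + br (br y z) x + br (br z x) y
                + tri x y z + tri y z x + tri z x y = 0"
    and LY2: "tri (br x y) z w + tri (br y z) x w + tri (br z x) y w = 0"
    and LY3: "tri x y (br z w) = br (tri x y z) w + br z (tri x y w)"
    and LY4: "tri x y (tri z w t) = tri (tri x y z) w t + tri z (tri x y w) t + tri z w (tri x y t)"

text \<open>
  A linear map out of the \<open>p\<close>-th tensor power of the exterior square is represented, by the
  universal property, by its values on decomposable arguments
  \<open>x\<^sub>1 \<and> y\<^sub>1 \<otimes> \<dots> \<otimes> x\<^sub>p \<and> y\<^sub>p\<close>: a function on lists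
  \<open>[(x\<^sub>1, y\<^sub>1), \<dots>, (x\<^sub>p, y\<^sub>p)]\<close> that is linear in each of the \<open>2p\<close> entries and vanishes as soon
  as \<open>x\<^sub>k = y\<^sub>k\<close> for some \<open>k\<close>. An argument that is a sum of two decomposables
  is therefore written as a sum of two values. Functions are set to \<open>0\<close> on lists of any other
  length, so that equality of cochains is equality in HOL.
\<close>

type_synonym 'g cochain = "(('g \<times> 'g) list \<Rightarrow> 'g) \<times> (('g \<times> 'g) list \<Rightarrow> 'g \<Rightarrow> 'g)"

text \<open>
  Indices below are 1-based, as is customary in the formulas: \<open>\<XX> X i\<close> is the pair
  \<open>(x\<^sub>i, y\<^sub>i)\<close>, and \<open>sel X \<sigma> i j\<close> is the list of the entries with index
  \<open>\<sigma>(i), \<dots>, \<sigma>(j)\<close>, empty if \<open>j < i\<close>.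
\<close>

abbreviation pair_at :: "('g \<times> 'g) list \<Rightarrow> nat \<Rightarrow> 'g \<times> 'g" ("\<XX>")
  where "\<XX> X i \<equiv> X ! (i - 1)"

abbreviation x_at :: "('g \<times> 'g) list \<Rightarrow> nat \<Rightarrow> 'g" ("\<xx>")
  where "\<xx> X i \<equiv> fst (\<XX> X i)"

abbreviation y_at :: "('g \<times> 'g) list \<Rightarrow> nat \<Rightarrow> 'g" ("\<yy>")
  where "\<yy> X i \<equiv> snd (\<XX> X i)"

definition sel :: "('g \<times> 'g) list \<Rightarrow> (nat \<Rightarrow> nat) \<Rightarrow> nat \<Rightarrow> nat \<Rightarrow> ('g \<times> 'g) list"
  where "sel X \<sigma> i j = map (\<lambda>r. \<XX> X (\<sigma> r)) [i..<Suc j]"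

definition omit :: "nat \<Rightarrow> ('g \<times> 'g) list \<Rightarrow> ('g \<times> 'g) list"
  where "omit k X = take (k - 1) X @ drop k X"

text \<open>\<open>Shuffle i j\<close> is the set of \<open>(i, j)\<close>-shuffles in the symmetric group on \<open>i + j\<close> letters.\<close>

definition Shuffle :: "nat \<Rightarrow> nat \<Rightarrow> (nat \<Rightarrow> nat) set"
  where "Shuffle i j = {\<sigma>. \<sigma> permutes {1..i + j} \<and>
    strict_mono_on {1..i} \<sigma> \<and> strict_mono_on {i + 1..i + j} \<sigma>}"

text \<open>Degree \<open>0\<close> has no first component; it is taken to be \<open>0\<close>.\<close>

definition hom0 :: "('g \<Rightarrow> 'g) \<Rightarrow> 'g::zero cochain"
  where "hom0 f = (\<lambda>X. 0, \<lambda>X x. if X = [] then f x else 0)"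

definition map0 :: "'g cochain \<Rightarrow> 'g \<Rightarrow> 'g"
  where "map0 P = snd P []"

context
  fixes scale :: "'k::field \<Rightarrow> 'g::ab_group_add \<Rightarrow> 'g" (infixr "*s" 75)
begin

definition HomI :: "nat \<Rightarrow> (('g \<times> 'g) list \<Rightarrow> 'g) set"
  where "HomI p = {F.
    (\<forall>X. length X \<noteq> p \<longrightarrow> F X = 0) \<and>
    (\<forall>X k. length X = p \<and> k < p \<longrightarrow>
       (\<forall>y. Vector_Spaces.linear scale scale (\<lambda>x. F (X[k := (x, y)]))) \<and>
       (\<forall>x. Vector_Spaces.linear scale scale (\<lambda>y. F (X[k := (x, y)]))) \<and>
       (\<forall>x. F (X[k := (x, x)]) = 0))}"

definition HomII :: "nat \<Rightarrow> (('g \<times> 'g) list \<Rightarrow> 'g \<Rightarrow> 'g) set"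
  where "HomII p = {G.
    (\<forall>z. (\<lambda>X. G X z) \<in> HomI p) \<and> (\<forall>X. Vector_Spaces.linear scale scale (G X))}"

definition Cochains :: "nat \<Rightarrow> 'g cochain set"
  where "Cochains p =
    (if p = 0 then hom0 ` {f. Vector_Spaces.linear scale scale f} else HomI p \<times> HomII p)"

definition cscale :: "'k \<Rightarrow> 'g cochain \<Rightarrow> 'g cochain"
  where "cscale c P = (\<lambda>X. c *s fst P X, \<lambda>X x. c *s snd P X x)"

text \<open>The operation \<open>\<circ>\<close> in positive degrees \<open>p\<close>, \<open>q\<close>, first and second component.\<close>

definition circI :: "nat \<Rightarrow> nat \<Rightarrow> 'g cochain \<Rightarrow> 'g cochain \<Rightarrow> ('g \<times> 'g) list \<Rightarrow> 'g"
  where "circI p q P Q X = (if length X = p + q then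
      (\<Sum>\<sigma> | \<sigma> \<in> Shuffle p q \<and> \<sigma> (p + q) = p + q.
         ((-1) ^ (p * q) * of_int (sign \<sigma>)) *s
           snd P (sel X \<sigma> 1 p) (fst Q (sel X \<sigma> (p + 1) (p + q))))
    + (\<Sum>k = 1..p. (-1) ^ ((k - 1) * q) *s (\<Sum>\<sigma> \<in> Shuffle (k - 1) q. of_int (sign \<sigma>) *s
         fst P (sel X \<sigma> 1 (k - 1)
                @ [(\<xx> X (k + q), snd Q (sel X \<sigma> k (k + q - 1)) (\<yy> X (k + q)))]
                @ drop (k + q) X)))
    + (\<Sum>k = 1..p. (-1) ^ ((k - 1) * q) *s (\<Sum>\<sigma> \<in> Shuffle (k - 1) q. of_int (sign \<sigma>) *s
         fst P (sel X \<sigma> 1 (k - 1)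
                @ [(snd Q (sel X \<sigma> k (k + q - 1)) (\<xx> X (k + q)), \<yy> X (k + q))]
                @ drop (k + q) X)))
    else 0)"

definition circII :: "nat \<Rightarrow> nat \<Rightarrow> 'g cochain \<Rightarrow> 'g cochain \<Rightarrow> ('g \<times> 'g) list \<Rightarrow> 'g \<Rightarrow> 'g"
  where "circII p q P Q X x = (if length X = p + q then
      (\<Sum>\<sigma> \<in> Shuffle p q.
         ((-1) ^ (p * q) * of_int (sign \<sigma>)) *s
           snd P (sel X \<sigma> 1 p) (snd Q (sel X \<sigma> (p + 1) (p + q)) x))
    + (\<Sum>k = 1..p. (-1) ^ ((k - 1) * q) *s (\<Sum>\<sigma> \<in> Shuffle (k - 1) q. of_int (sign \<sigma>) *s
         snd P (sel X \<sigma> 1 (k - 1)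
                @ [(\<xx> X (k + q), snd Q (sel X \<sigma> k (k + q - 1)) (\<yy> X (k + q)))]
                @ drop (k + q) X) x))
    + (\<Sum>k = 1..p. (-1) ^ ((k - 1) * q) *s (\<Sum>\<sigma> \<in> Shuffle (k - 1) q. of_int (sign \<sigma>) *s
         snd P (sel X \<sigma> 1 (k - 1)
                @ [(snd Q (sel X \<sigma> k (k + q - 1)) (\<xx> X (k + q)), \<yy> X (k + q))]
                @ drop (k + q) X) x))
    else 0)"

text \<open>
  \<open>P \<circ> f\<close> for \<open>P\<close> of positive degree \<open>p\<close> and \<open>f\<close> of degree \<open>0\<close>; the argument
  \<open>x\<^sub>k \<and> f(y\<^sub>k) + f(x\<^sub>k) \<and> y\<^sub>k\<close> contributes two summands.
\<close>

definition circ_right0 :: "nat \<Rightarrow> 'g cochain \<Rightarrow> ('g \<Rightarrow> 'g) \<Rightarrow> 'g cochain"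
  where "circ_right0 p P f =
    (\<lambda>X. if length X = p then
       (\<Sum>k = 1..p. fst P (X[k - 1 := (\<xx> X k, f (\<yy> X k))])
                  + fst P (X[k - 1 := (f (\<xx> X k), \<yy> X k)])) else 0,
     \<lambda>X x. if length X = p then
       (\<Sum>k = 1..p. snd P (X[k - 1 := (\<xx> X k, f (\<yy> X k))]) x
                  + snd P (X[k - 1 := (f (\<xx> X k), \<yy> X k)]) x) + snd P X (f x) else 0)"

definition circ_left0 :: "nat \<Rightarrow> ('g \<Rightarrow> 'g) \<Rightarrow> 'g cochain \<Rightarrow> 'g cochain"
  where "circ_left0 q f Q =
    (\<lambda>X. if length X = q then f (fst Q X) else 0,
     \<lambda>X x. if length X = q then f (snd Q X x) else 0)"

definition circ :: "nat \<Rightarrow> nat \<Rightarrow> 'g cochain \<Rightarrow> 'g cochain \<Rightarrow> 'g cochain"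
  where "circ p q P Q =
    (if p = 0 \<and> q = 0 then hom0 (map0 P \<circ> map0 Q)
     else if p = 0 then circ_left0 q (map0 P) Q
     else if q = 0 then circ_right0 p P (map0 Q)
     else (circI p q P Q, circII p q P Q))"

definition LieY_bracket :: "nat \<Rightarrow> nat \<Rightarrow> 'g cochain \<Rightarrow> 'g cochain \<Rightarrow> 'g cochain"
  where "LieY_bracket p q P Q = circ p q P Q - cscale ((-1) ^ (p * q)) (circ q p Q P)"

end

definition LY_pair :: "('g \<Rightarrow> 'g \<Rightarrow> 'g) \<Rightarrow> ('g \<Rightarrow> 'g \<Rightarrow> 'g \<Rightarrow> 'g) \<Rightarrow> 'g::zero cochain"
  where "LY_pair br tri =
    (\<lambda>X. if length X = 1 then br (\<xx> X 1) (\<yy> X 1) else 0,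
     \<lambda>X z. if length X = 1 then tri (\<xx> X 1) (\<yy> X 1) z else 0)"

context
  fixes scale :: "'k::field \<Rightarrow> 'g::ab_group_add \<Rightarrow> 'g" (infixr "*s" 75)
    and br :: "'g \<Rightarrow> 'g \<Rightarrow> 'g"
    and tri :: "'g \<Rightarrow> 'g \<Rightarrow> 'g \<Rightarrow> 'g"
begin

definition d_LY :: "nat \<Rightarrow> 'g cochain \<Rightarrow> 'g cochain"
  where "d_LY n F = LieY_bracket scale 1 n (LY_pair br tri) F"

definition ad_rho :: "'g \<Rightarrow> 'g \<Rightarrow> 'g"
  where "ad_rho x z = br x z"

definition ad_mu :: "'g \<Rightarrow> 'g \<Rightarrow> 'g \<Rightarrow> 'g"
  where "ad_mu x y z = tri z x y"

definition ad_D :: "'g \<Rightarrow> 'g \<Rightarrow> 'g \<Rightarrow> 'g"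
  where "ad_D x y z = tri x y z"

text \<open>
  In the next two definitions \<open>\<XX> X k \<circ> \<XX> X l\<close>, the sum
  \<open>[x\<^sub>k, y\<^sub>k, x\<^sub>l] \<and> y\<^sub>l + x\<^sub>l \<and> [x\<^sub>k, y\<^sub>k, y\<^sub>l]\<close> of two decomposables (ternary brackets),
  replaces the \<open>l\<close>-th argument before the \<open>k\<close>-th one, \<open>k < l\<close>, is omitted.
\<close>

definition deltaI :: "nat \<Rightarrow> 'g cochain \<Rightarrow> ('g \<times> 'g) list \<Rightarrow> 'g"
  where "deltaI n F X = (if length X = n + 1 then
      (-1) ^ n *s
        (ad_rho (\<xx> X (n + 1)) (snd F (take n X) (\<yy> X (n + 1)))
         - ad_rho (\<yy> X (n + 1)) (snd F (take n X) (\<xx> X (n + 1)))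
         - snd F (take n X) (br (\<xx> X (n + 1)) (\<yy> X (n + 1))))
    + (\<Sum>k = 1..n. (-1) ^ (k + 1) *s ad_D (\<xx> X k) (\<yy> X k) (fst F (omit k X)))
    + (\<Sum>k = 1..n + 1. \<Sum>l = k + 1..n + 1. (-1) ^ k *s
         (fst F (omit k (X[l - 1 := (tri (\<xx> X k) (\<yy> X k) (\<xx> X l), \<yy> X l)]))
          + fst F (omit k (X[l - 1 := (\<xx> X l, tri (\<xx> X k) (\<yy> X k) (\<yy> X l))]))))
    else 0)"

definition deltaII :: "nat \<Rightarrow> 'g cochain \<Rightarrow> ('g \<times> 'g) list \<Rightarrow> 'g \<Rightarrow> 'g"
  where "deltaII n F X z = (if length X = n + 1 then
      (-1) ^ n *s
        (ad_mu (\<yy> X (n + 1)) z (snd F (take n X) (\<xx> X (n + 1)))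
         - ad_mu (\<xx> X (n + 1)) z (snd F (take n X) (\<yy> X (n + 1))))
    + (\<Sum>k = 1..n + 1. (-1) ^ (k + 1) *s ad_D (\<xx> X k) (\<yy> X k) (snd F (omit k X) z))
    + (\<Sum>k = 1..n + 1. \<Sum>l = k + 1..n + 1. (-1) ^ k *s
         (snd F (omit k (X[l - 1 := (tri (\<xx> X k) (\<yy> X k) (\<xx> X l), \<yy> X l)])) z
          + snd F (omit k (X[l - 1 := (\<xx> X l, tri (\<xx> X k) (\<yy> X k) (\<yy> X l))])) z))
    + (\<Sum>k = 1..n + 1. (-1) ^ k *s snd F (omit k X) (tri (\<xx> X k) (\<yy> X k) z))
    else 0)"

definition delta0 :: "('g \<Rightarrow> 'g) \<Rightarrow> 'g cochain"
  where "delta0 f =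
    (\<lambda>X. if length X = 1 then
       (let x = \<xx> X 1; y = \<yy> X 1
        in ad_rho x (f y) - ad_rho y (f x) - f (br x y)) else 0,
     \<lambda>X z. if length X = 1 then
       (let x = \<xx> X 1; y = \<yy> X 1
        in ad_D x y (f z) + ad_mu y z (f x) - ad_mu x z (f y) - f (tri x y z)) else 0)"

definition yamaguti_delta :: "nat \<Rightarrow> 'g cochain \<Rightarrow> 'g cochain"
  where "yamaguti_delta n F =
    (if n = 0 then delta0 (map0 F) else (deltaI n F, deltaII n F))"

end

lemma (in lie_yamaguti_algebra) LY_pair_in_Cochains: "LY_pair br tri \<in> Cochains scale 1"
proof -
  have zero: "Vector_Spaces.linear scale scale (\<lambda>x. 0)"
    using vector_space_axioms by (simp add: Vector_Spaces.linear_iff)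
  have "Vector_Spaces.linear scale scale (\<lambda>z. if b then tri x y z else 0)" for b x y
    using tri_linear3 zero by (cases b) auto
  then show ?thesis
    using br_linear1 br_linear2 tri_linear1 tri_linear2
    by (auto simp: Cochains_def HomI_def HomII_def LY_pair_def br_alt tri_alt zero)
qed

end

theory Submission
  imports Defs
begin

text \<open>
  In \<open>\<Pi> \<circ> F\<close> and \<open>F \<circ> \<Pi>\<close> only \<open>(1, n)\<close>- and \<open>(m, 1)\<close>-shuffles occur. Such a shuffle is determined
  by the value \<open>b\<close> at the isolated position \<open>a\<close>: it is the cycle that moves \<open>a\<close> to \<open>b\<close> and keeps the
  order of all other letters, its sign is \<open>(-1)\<^bsup>a+b\<^esup>\<close>, and the remaining arguments form the list with
  the \<open>b\<close>-th entry omitted. The two sides then agree term by term, up to the skew symmetry of the two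
  brackets.
\<close>

section \<open>Cycles moving one letter, and their signs\<close>

definition cycle_to :: "nat \<Rightarrow> nat \<Rightarrow> nat \<Rightarrow> nat"
  where "cycle_to a b i = (if i = a then b else if a < i \<and> i \<le> b then i - 1
    else if b \<le> i \<and> i < a then i + 1 else i)"

lemma cycle_to_same [simp]: "cycle_to a a = id"
  by (auto simp: cycle_to_def fun_eq_iff)

lemma cycle_to_apply_same [simp]: "cycle_to a b a = b"
  by (simp add: cycle_to_def)

text \<open>Valid on both sides of \<open>a\<close>: the transposition lengthens the cycle if
  \<open>b \<ge> a\<close> and shortens it if \<open>b < a\<close>. Hence the sign alternates in
  \<open>b\<close> throughout.\<close>

lemma cycle_to_Suc: "cycle_to a (Suc b) = Transposition.transpose b (Suc b) \<circ> cycle_to a b"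
  by (auto simp: cycle_to_def fun_eq_iff Transposition.transpose_def)

lemma cycle_to_inverse: "cycle_to b a (cycle_to a b i) = i"
  by (auto simp: cycle_to_def)

lemma cycle_to_permutes:
  assumes "a \<in> {m..n}" "b \<in> {m..n}"
  shows "cycle_to a b permutes {m..n}"
proof (rule bij_imp_permutes)
  show "bij_betw (cycle_to a b) {m..n} {m..n}"
    by (rule bij_betw_byWitness[where f' = "cycle_to b a"])
      (use assms in \<open>auto simp: cycle_to_inverse\<close>, auto simp: cycle_to_def split: if_splits)
qed (use assms in \<open>auto simp: cycle_to_def\<close>)

lemma permutation_cycle_to: "permutation (cycle_to a b)"
  using cycle_to_permutes[of a 0 "max a b" b] by (auto intro: permutation_permutes[THEN iffD2])

lemma sign_cycle_to_Suc: "sign (cycle_to a (Suc b)) = - sign (cycle_to a b)"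
  by (simp add: cycle_to_Suc sign_compose permutation_cycle_to permutation_swap_id sign_swap_id)

lemma sign_cycle_to: "sign (cycle_to a b) = (-1) ^ (a + b)"
proof -
  have up: "sign (cycle_to a (a + d)) = (-1) ^ d" for d
    by (induction d) (simp_all add: sign_cycle_to_Suc)
  \<comment> \<open>For \<open>b < a\<close> the choice \<open>d = a - b\<close> climbs to
    \<open>cycle_to a a\<close>, the identity, whose sign is known.\<close>
  have step: "sign (cycle_to a (b + d)) = (-1) ^ d * sign (cycle_to a b)" for d
    by (induction d) (simp_all add: sign_cycle_to_Suc)
  show ?thesis
  proof (cases "a \<le> b")
    case True
    then have "b = a + (b - a)" "(-1 :: int) ^ (b - a) = (-1) ^ (a + b)"
      by (simp_all add: minus_one_power_iff)
    then show ?thesis by (metis up)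
  next
    case False
    then have "(-1) ^ (a - b) * sign (cycle_to a b) = 1" "even (a - b) \<longleftrightarrow> even (a + b)"
      using step[of "a - b"] by simp_all
    then show ?thesis by (auto simp: minus_one_power_iff split: if_splits)
  qed
qed

section \<open>Shuffles with a block of length at most one\<close>

text \<open>An increasing map carries the sorted list of a finite set to the sorted list of its
  image, so the image determines the map.\<close>

lemma strict_mono_on_same_image_imp_eq:
  fixes f g :: "nat \<Rightarrow> nat"
  assumes "finite A" "strict_mono_on A f" "strict_mono_on A g" "f ` A = g ` A" "x \<in> A"
  shows "f x = g x"
proof -
  have "map h (sorted_list_of_set A) = sorted_list_of_set (h ` A)"
    if "strict_mono_on A h" for h :: "nat \<Rightarrow> nat"
  proof (rule sorted_distinct_set_unique)
    show "sorted (map h (sorted_list_of_set A))"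
      using that \<open>finite A\<close> by (auto simp: sorted_map strict_mono_on_leD
          intro!: sorted_wrt_mono_rel[OF _ sorted_sorted_list_of_set[of A]])
  qed (use that \<open>finite A\<close> in \<open>auto simp: distinct_map strict_mono_on_imp_inj_on\<close>)
  then have "map f (sorted_list_of_set A) = map g (sorted_list_of_set A)"
    using assms by metis
  then show ?thesis using assms by auto
qed

text \<open>Once the value \<open>b\<close> at \<open>a\<close> is fixed, the other letters must
  fill \<open>{1..n} - {b}\<close> in increasing order, which leaves exactly one
  permutation.\<close>

lemma permutes_mono_off_point:
  assumes "a \<in> {1..n}"
  shows "{\<sigma>. \<sigma> permutes {1..n} \<and> strict_mono_on ({1..n} - {a}) \<sigma>} = cycle_to a ` {1..n}"
proof (intro equalityI subsetI)
  have mono: "strict_mono_on ({1..n} - {a}) (cycle_to a b)" for b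
    by (auto simp: strict_mono_on_def cycle_to_def)
  fix \<sigma>
  {
    assume "\<sigma> \<in> cycle_to a ` {1..n}"
    then show "\<sigma> \<in> {\<sigma>. \<sigma> permutes {1..n} \<and> strict_mono_on ({1..n} - {a}) \<sigma>}"
      using cycle_to_permutes assms mono by auto
  next
    assume "\<sigma> \<in> {\<sigma>. \<sigma> permutes {1..n} \<and> strict_mono_on ({1..n} - {a}) \<sigma>}"
    then have \<sigma>: "\<sigma> permutes {1..n}" "strict_mono_on ({1..n} - {a}) \<sigma>" by auto
    define b where "b = \<sigma> a"
    have b: "b \<in> {1..n}" using \<sigma> assms permutes_in_image unfolding b_def by metis
    have image: "\<tau> ` ({1..n} - {a}) = {1..n} - {b}" if "\<tau> permutes {1..n}" "\<tau> a = b" for \<tau>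
      using that by (simp add: image_set_diff permutes_inj permutes_image)
    have c: "cycle_to a b permutes {1..n}" using cycle_to_permutes assms b by blast
    have "\<sigma> i = cycle_to a b i" for i
    proof -
      consider "i \<in> {1..n} - {a}" | "i = a" | "i \<notin> {1..n}" by blast
      then show ?thesis
      proof cases
        case 1
        have "\<sigma> ` ({1..n} - {a}) = cycle_to a b ` ({1..n} - {a})"
          using image[OF \<sigma>(1)] image[OF c] by (simp add: b_def)
        then show ?thesis
          using strict_mono_on_same_image_imp_eq[OF _ \<sigma>(2) mono _ 1] by blast
      next
        case 3
        then show ?thesis using \<sigma>(1) c permutes_not_in by metis
      qed (simp add: b_def)
    qed
    then show "\<sigma> \<in> cycle_to a ` {1..n}" using b by blast
  }
qed

lemma inj_on_cycle_to: "inj_on (cycle_to a) A"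
  by (metis cycle_to_apply_same inj_onI)

text \<open>A block of length one imposes no order condition, so being a shuffle means being
  increasing off position \<open>1\<close>.\<close>

lemma Shuffle_1_left: "Shuffle 1 n = cycle_to 1 ` {1..n + 1}"
proof -
  have "{1 + 1..1 + n} = {1..1 + n} - {1}" "strict_mono_on {1..1::nat} \<sigma>" for \<sigma> :: "nat \<Rightarrow> nat"
    by (auto simp: strict_mono_on_def)
  then have "Shuffle 1 n = {\<sigma>. \<sigma> permutes {1..1 + n} \<and> strict_mono_on ({1..1 + n} - {1}) \<sigma>}"
    unfolding Shuffle_def by presburger
  also have "\<dots> = cycle_to 1 ` {1..1 + n}"
    by (rule permutes_mono_off_point) simp
  finally show ?thesis by (simp only: add.commute)
qed

lemma Shuffle_1_right: "Shuffle m 1 = cycle_to (m + 1) ` {1..m + 1}"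
proof -
  have "{1..m} = {1..m + 1} - {m + 1}" "strict_mono_on {m + 1..m + 1} \<sigma>" for \<sigma> :: "nat \<Rightarrow> nat"
    by (auto simp: strict_mono_on_def)
  then have "Shuffle m 1 = {\<sigma>. \<sigma> permutes {1..m + 1} \<and> strict_mono_on ({1..m + 1} - {m + 1}) \<sigma>}"
    unfolding Shuffle_def by presburger
  also have "\<dots> = cycle_to (m + 1) ` {1..m + 1}"
    by (rule permutes_mono_off_point) simp
  finally show ?thesis .
qed

text \<open>Serves the insertion sums of a composition with left degree one, where
  \<open>k = 1\<close> is the only index.\<close>

lemma Shuffle_0_left: "Shuffle 0 n = {id}"
proof (intro equalityI subsetI)
  fix \<sigma>
  assume "\<sigma> \<in> Shuffle 0 n"
  then have \<sigma>: "\<sigma> permutes {1..n}" "strict_mono_on {1..n} \<sigma>" by (auto simp: Shuffle_def)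
  have "\<sigma> i = i" for i
    using strict_mono_on_same_image_imp_eq[OF _ \<sigma>(2), of id i] \<sigma>
    by (cases "i \<in> {1..n}") (auto simp: permutes_image permutes_not_in strict_mono_on_def)
  then show "\<sigma> \<in> {id}" by auto
qed (auto simp: Shuffle_def strict_mono_on_def permutes_id)

text \<open>Among these cycles only the one with \<open>k = n + 1\<close> moves the last letter.
  This is why the \<open>ad_D\<close> sum in \<open>deltaI\<close> stops at \<open>n\<close>. For
  \<open>n = 0\<close> the identity would satisfy the condition while the right-hand side is
  empty.\<close>

lemma Shuffle_1_left_fix:
  assumes "n \<ge> 1"
  shows "{\<sigma>. \<sigma> \<in> Shuffle 1 n \<and> \<sigma> (1 + n) = 1 + n} = cycle_to 1 ` {1..n}"
proof -
  have "cycle_to 1 k (1 + n) = 1 + n \<longleftrightarrow> k \<le> n" if "k \<in> {1..n + 1}" for k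
    using that assms by (auto simp: cycle_to_def)
  then show ?thesis unfolding Shuffle_1_left by force
qed

lemma Shuffle_1_right_fix: "{\<sigma>. \<sigma> \<in> Shuffle m 1 \<and> \<sigma> (m + 1) = m + 1} = {id}"
proof -
  have "id \<in> Shuffle m 1"
    unfolding Shuffle_1_right by (rule image_eqI[of _ _ "m + 1"]) simp_all
  then show ?thesis by (auto simp: Shuffle_1_right simp del: One_nat_def)
qed

section \<open>Selected arguments, omission, and reindexing of sums\<close>

lemma length_sel [simp]: "length (sel X \<sigma> i j) = Suc j - i"
  by (simp add: sel_def del: upt_Suc)

lemma nth_sel [simp]: "r < Suc j - i \<Longrightarrow> sel X \<sigma> i j ! r = \<XX> X (\<sigma> (i + r))"
  by (simp add: sel_def del: upt_Suc)

lemma sel_singleton [simp]: "sel X \<sigma> i i = [\<XX> X (\<sigma> i)]"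
  by (simp add: sel_def)

lemma sel_id: "n \<le> length X \<Longrightarrow> sel X id 1 n = take n X"
  by (rule nth_equalityI) auto

lemma length_omit: "k \<in> {1..length X} \<Longrightarrow> length (omit k X) = length X - 1"
  by (auto simp: omit_def)

lemma nth_omit:
  assumes "k \<in> {1..length X}" "r < length X - 1"
  shows "omit k X ! r = X ! (if r < k - 1 then r else r + 1)"
proof -
  have "min (length X) (k - 1) = k - 1" using assms by auto
  then show ?thesis using assms by (auto simp: omit_def nth_append)
qed

lemma sel_cycle_to_left:
  assumes "length X = n + 1" "k \<in> {1..n + 1}"
  shows "sel X (cycle_to 1 k) 2 (n + 1) = omit k X"
  using assms by (intro nth_equalityI) (auto simp: length_omit nth_omit cycle_to_def)

text \<open>\<open>X\<close> may be longer than \<open>m + 1\<close>, because the insertion sums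
  shuffle only an initial segment of the arguments.\<close>

lemma sel_cycle_to_right:
  assumes "m + 1 \<le> length X" "k \<in> {1..m + 1}"
  shows "sel X (cycle_to (m + 1) k) 1 m = omit k (take (m + 1) X)"
  using assms by (intro nth_equalityI) (auto simp: length_omit nth_omit cycle_to_def)

text \<open>The omitted entry precedes the replaced one, which has 1-based index
  \<open>k + 1\<close>. This links the arguments of the composition to those of the
  coboundary.\<close>

lemma omit_update:
  "k < length X \<Longrightarrow> j \<in> {1..k} \<Longrightarrow>
    omit j (X[k := p]) = omit j (take k X) @ [p] @ drop (k + 1) X"
  by (auto simp: omit_def upd_conv_take_nth_drop min_def)

text \<open>With \<open>l = k + 1\<close>, both sides run over the pairs
  \<open>j < l \<le> n + 1\<close>; the row \<open>j = n + 1\<close> on the right is empty.\<close>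

lemma sum_triangle_Suc:
  fixes h :: "nat \<Rightarrow> nat \<Rightarrow> 'a::comm_monoid_add"
  shows "(\<Sum>k = 1..n. \<Sum>j = 1..k. h j (k + 1)) = (\<Sum>j = 1..n + 1. \<Sum>l = j + 1..n + 1. h j l)"
proof (induction n)
  case (Suc n)
  have "(\<Sum>l = j + 1..Suc n + 1. h j l) = (\<Sum>l = j + 1..n + 1. h j l) + h j (Suc n + 1)"
    if "j \<in> {1..n + 1}" for j
    using that by (simp add: sum.nat_ivl_Suc')
  then show ?case using Suc by (simp add: sum.distrib)
qed simp

section \<open>Compositions with the structure pair, and comparison with the coboundary\<close>

context lie_yamaguti_algebra
begin

lemma br_skew: "br x y = - br y x"
proof -
  have "br (x + y) (x + y) = br x x + br y x + (br x y + br y y)"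
    using br_linear1 br_linear2 by (simp add: Vector_Spaces.linear_iff)
  then have "br x y + br y x = 0" by (simp add: br_alt add.commute)
  then show ?thesis by (simp add: eq_neg_iff_add_eq_0)
qed

lemma tri_skew: "tri x y z = - tri y x z"
proof -
  have "tri (x + y) (x + y) z = tri x x z + tri y x z + (tri x y z + tri y y z)"
    using tri_linear1 tri_linear2 by (simp add: Vector_Spaces.linear_iff)
  then have "tri x y z + tri y x z = 0" by (simp add: tri_alt add.commute)
  then show ?thesis by (simp add: eq_neg_iff_add_eq_0)
qed

lemma snd_LY_pair_singleton [simp]: "snd (LY_pair br tri) [p] z = tri (fst p) (snd p) z"
  by (simp add: LY_pair_def)

lemma fst_LY_pair_singleton [simp]: "fst (LY_pair br tri) [p] = br (fst p) (snd p)"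
  by (simp add: LY_pair_def)

text \<open>The sign is \<open>(-1) ^ n\<close> times that of \<open>cycle_to 1 k\<close>. Each
  insertion sum reduces to \<open>k = 1\<close> with the identity shuffle and yields one
  \<open>br\<close> term.\<close>

lemma circI_LY_pair_left:
  assumes "length X = n + 1" "n \<ge> 1"
  shows "circI scale 1 n (LY_pair br tri) F X =
    (\<Sum>k = 1..n. (-1) ^ (n + k + 1) *s tri (\<xx> X k) (\<yy> X k) (fst F (omit k X)))
    + br (\<xx> X (n + 1)) (snd F (take n X) (\<yy> X (n + 1)))
    + br (snd F (take n X) (\<xx> X (n + 1))) (\<yy> X (n + 1))"
proof -
  have "(\<Sum>\<sigma> | \<sigma> \<in> Shuffle 1 n \<and> \<sigma> (1 + n) = 1 + n. ((-1) ^ (1 * n) * of_int (sign \<sigma>)) *s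
      snd (LY_pair br tri) (sel X \<sigma> 1 1) (fst F (sel X \<sigma> (1 + 1) (1 + n)))) =
    (\<Sum>k = 1..n. (-1) ^ (n + k + 1) *s tri (\<xx> X k) (\<yy> X k) (fst F (omit k X)))"
    unfolding Shuffle_1_left_fix[OF assms(2)] sum.reindex[OF inj_on_cycle_to]
    using sel_cycle_to_left[OF assms(1)]
    by (intro sum.cong) (simp_all add: sign_cycle_to power_add numeral_2_eq_2)
  then show ?thesis
    using assms sel_id[of n X] unfolding circI_def
    \<comment> \<open>For \<open>k = 1\<close> no argument precedes the inserted pair:
      \<open>sel X \<sigma> 1 0\<close> is empty.\<close>
    by (simp add: Shuffle_0_left sel_def[of _ _ 1 0] add.commute del: One_nat_def)
qed

lemma circII_LY_pair_left:
  assumes "length X = n + 1"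
  shows "circII scale 1 n (LY_pair br tri) F X z =
    (\<Sum>k = 1..n + 1. (-1) ^ (n + k + 1) *s tri (\<xx> X k) (\<yy> X k) (snd F (omit k X) z))
    + tri (\<xx> X (n + 1)) (snd F (take n X) (\<yy> X (n + 1))) z
    + tri (snd F (take n X) (\<xx> X (n + 1))) (\<yy> X (n + 1)) z"
proof -
  have "(\<Sum>\<sigma> \<in> Shuffle 1 n. ((-1) ^ (1 * n) * of_int (sign \<sigma>)) *s
      snd (LY_pair br tri) (sel X \<sigma> 1 1) (snd F (sel X \<sigma> (1 + 1) (1 + n)) z)) =
    (\<Sum>k = 1..n + 1. (-1) ^ (n + k + 1) *s tri (\<xx> X k) (\<yy> X k) (snd F (omit k X) z))"
    unfolding Shuffle_1_left sum.reindex[OF inj_on_cycle_to]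
    using sel_cycle_to_left[OF assms]
    by (intro sum.cong) (simp_all add: sign_cycle_to power_add numeral_2_eq_2)
  then show ?thesis
    using assms sel_id[of n X] unfolding circII_def
    by (simp add: Shuffle_0_left sel_def[of _ _ 1 0] add.commute del: One_nat_def)
qed

text \<open>The new argument sits at position \<open>l = k + 1\<close>, and the letter that the shuffle puts
  at position \<open>k\<close> is the omitted one.\<close>

lemma sum_Shuffle_insert:
  assumes "length X = n + 1"
  shows "(\<Sum>k = 1..n. (-1) ^ ((k - 1) * 1) *s (\<Sum>\<sigma> \<in> Shuffle (k - 1) 1. of_int (sign \<sigma>) *s
      H (sel X \<sigma> 1 (k - 1) @ [B (hd (sel X \<sigma> k (k + 1 - 1))) (\<XX> X (k + 1))] @ drop (k + 1) X))) =
    (\<Sum>k = 1..n + 1. \<Sum>l = k + 1..n + 1.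
      (-1) ^ (k + 1) *s H (omit k (X[l - 1 := B (\<XX> X k) (\<XX> X l)])))"
proof -
  have row: "(-1) ^ ((k - 1) * 1) *s (\<Sum>\<sigma> \<in> Shuffle (k - 1) 1. of_int (sign \<sigma>) *s
      H (sel X \<sigma> 1 (k - 1) @ [B (hd (sel X \<sigma> k (k + 1 - 1))) (\<XX> X (k + 1))] @ drop (k + 1) X)) =
    (\<Sum>j = 1..k. (-1) ^ (j + 1) *s H (omit j (X[k + 1 - 1 := B (\<XX> X j) (\<XX> X (k + 1))])))"
    if k: "k \<in> {1..n}" for k
  proof -
    \<comment> \<open>The prefactor of the \<open>k\<close>-th insertion times the sign of
      \<open>cycle_to k j\<close> no longer depends on \<open>k\<close>.\<close>
    have "(-1) ^ (k - 1) * (-1) ^ (k + j) = ((-1) ^ (j + 1) :: 'k)" for j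
      using k by (auto simp: minus_one_power_iff)
    moreover have "sel X (cycle_to k j) 1 (k - 1) = omit j (take k X)" if "j \<in> {1..k}" for j
      using sel_cycle_to_right[of "k - 1" X j] that k assms by simp
    moreover have "Shuffle (k - 1) 1 = cycle_to k ` {1..k}"
      using Shuffle_1_right[of "k - 1"] k by simp
    ultimately show ?thesis
      using k assms
      by (simp add: sum.reindex[OF inj_on_cycle_to] scale_sum_right sign_cycle_to omit_update
          del: One_nat_def)
  qed
  have "(\<Sum>k = 1..n. \<Sum>j = 1..k.
      (-1) ^ (j + 1) *s H (omit j (X[k + 1 - 1 := B (\<XX> X j) (\<XX> X (k + 1))]))) =
    (\<Sum>k = 1..n + 1. \<Sum>l = k + 1..n + 1.
      (-1) ^ (k + 1) *s H (omit k (X[l - 1 := B (\<XX> X k) (\<XX> X l)])))"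
    by (rule sum_triangle_Suc)
  with row show ?thesis by (metis (no_types, lifting) sum.cong)
qed

text \<open>Exposes the single selected entry as a \<open>hd\<close>, the shape that
  \<open>B\<close> takes in \<open>sum_Shuffle_insert\<close>.\<close>

lemma snd_LY_pair_sel: "snd (LY_pair br tri) (sel X \<sigma> k (k + 1 - 1)) z =
    tri (fst (hd (sel X \<sigma> k (k + 1 - 1)))) (snd (hd (sel X \<sigma> k (k + 1 - 1)))) z"
  by simp

text \<open>The sum with \<open>br\<close> keeps only the identity shuffle. The two choices of
  \<open>B\<close> put the ternary bracket into the second and the first entry of the
  \<open>l\<close>-th pair.\<close>

lemma circI_LY_pair_right:
  assumes "length X = n + 1"
  shows "circI scale n 1 F (LY_pair br tri) X =
    (-1) ^ n *s snd F (take n X) (br (\<xx> X (n + 1)) (\<yy> X (n + 1)))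
    + (\<Sum>k = 1..n + 1. \<Sum>l = k + 1..n + 1. (-1) ^ (k + 1) *s
         (fst F (omit k (X[l - 1 := (tri (\<xx> X k) (\<yy> X k) (\<xx> X l), \<yy> X l)]))
          + fst F (omit k (X[l - 1 := (\<xx> X l, tri (\<xx> X k) (\<yy> X k) (\<yy> X l))]))))"
  unfolding circI_def Shuffle_1_right_fix snd_LY_pair_sel
    sum_Shuffle_insert[OF assms, where B = "\<lambda>p q. (fst q, tri (fst p) (snd p) (snd q))"]
    sum_Shuffle_insert[OF assms, where B = "\<lambda>p q. (tri (fst p) (snd p) (fst q), snd q)"]
  using assms sel_id[of n X]
  by (simp add: scale_right_distrib sum.distrib add.commute del: One_nat_def)

lemma circII_LY_pair_right:
  assumes "length X = n + 1"
  shows "circII scale n 1 F (LY_pair br tri) X z =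
    (\<Sum>k = 1..n + 1. (-1) ^ (k + 1) *s snd F (omit k X) (tri (\<xx> X k) (\<yy> X k) z))
    + (\<Sum>k = 1..n + 1. \<Sum>l = k + 1..n + 1. (-1) ^ (k + 1) *s
         (snd F (omit k (X[l - 1 := (tri (\<xx> X k) (\<yy> X k) (\<xx> X l), \<yy> X l)])) z
          + snd F (omit k (X[l - 1 := (\<xx> X l, tri (\<xx> X k) (\<yy> X k) (\<yy> X l))])) z))"
proof -
  \<comment> \<open>The prefactor \<open>(-1) ^ (n * 1)\<close> meets the sign of
    \<open>cycle_to (n + 1) k\<close>.\<close>
  have "(-1) ^ n * (-1) ^ (n + 1 + k) = ((-1) ^ (k + 1) :: 'k)" for k
    by (auto simp: minus_one_power_iff)
  then have "(\<Sum>\<sigma> \<in> Shuffle n 1. ((-1) ^ (n * 1) * of_int (sign \<sigma>)) *s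
      snd F (sel X \<sigma> 1 n) (snd (LY_pair br tri) (sel X \<sigma> (n + 1) (n + 1)) z)) =
    (\<Sum>k = 1..n + 1. (-1) ^ (k + 1) *s snd F (omit k X) (tri (\<xx> X k) (\<yy> X k) z))"
    unfolding Shuffle_1_right sum.reindex[OF inj_on_cycle_to]
    using sel_cycle_to_right[of n X] assms
    by (intro sum.cong) (simp_all add: sign_cycle_to del: One_nat_def)
  then show ?thesis
    unfolding circII_def snd_LY_pair_sel
      sum_Shuffle_insert[OF assms, where H = "\<lambda>Y. snd F Y z" and
        B = "\<lambda>p q. (fst q, tri (fst p) (snd p) (snd q))"]
      sum_Shuffle_insert[OF assms, where H = "\<lambda>Y. snd F Y z" and
        B = "\<lambda>p q. (tri (fst p) (snd p) (fst q), snd q)"]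
    using assms
    by (simp add: scale_right_distrib sum.distrib add.commute del: One_nat_def)
qed

lemma minus_one_power_scale: "(-1) ^ n *s ((-1) ^ n *s x) = x"
  by (simp flip: power_mult_distrib)

text \<open>The two factors \<open>(-1) ^ n\<close> cancel on the second composition; its minus sign
  turns \<open>(-1) ^ (k + 1)\<close> into the \<open>(-1) ^ k\<close> of the coboundary.\<close>

lemma deltaI_eq:
  assumes "n \<ge> 1"
  shows "deltaI scale br tri n F X = (-1) ^ n *s
    (circI scale 1 n (LY_pair br tri) F X - (-1) ^ n *s circI scale n 1 F (LY_pair br tri) X)"
proof (cases "length X = n + 1")
  case True
  have "(-1) ^ n * (-1) ^ (n + k + 1) = ((-1) ^ (k + 1) :: 'k)"
    and minus: "(-1) ^ (k + 1) = - ((-1) ^ k :: 'k)" for k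
    by (auto simp: minus_one_power_iff)
  \<comment> \<open>The composition has the value of \<open>F\<close> in the left slot of
    \<open>br\<close>, whereas \<open>ad_rho\<close> expects it on the right.\<close>
  moreover have "br (snd F (take n X) (\<xx> X (n + 1))) (\<yy> X (n + 1)) =
      - br (\<yy> X (n + 1)) (snd F (take n X) (\<xx> X (n + 1)))"
    by (rule br_skew)
  ultimately show ?thesis
    unfolding deltaI_def circI_LY_pair_left[OF True assms] circI_LY_pair_right[OF True]
    using True
    by (simp add: ad_rho_def ad_D_def scale_right_distrib scale_right_diff_distrib scale_sum_right
        minus_one_power_scale minus sum.distrib sum_negf sum_subtractf
        algebra_simps del: One_nat_def)
qed (simp add: deltaI_def circI_def)

lemma deltaII_eq:
  "deltaII scale tri n F X z = (-1) ^ n *s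
    (circII scale 1 n (LY_pair br tri) F X z - (-1) ^ n *s circII scale n 1 F (LY_pair br tri) X z)"
proof (cases "length X = n + 1")
  case True
  have "(-1) ^ n * (-1) ^ (n + k + 1) = ((-1) ^ (k + 1) :: 'k)"
    and minus: "(-1) ^ (k + 1) = - ((-1) ^ k :: 'k)" for k
    by (auto simp: minus_one_power_iff)
  \<comment> \<open>\<open>ad_mu\<close> has the value of \<open>F\<close> in the first slot of
    \<open>tri\<close>; here the composition has it in the second.\<close>
  moreover have "tri (\<xx> X (n + 1)) (snd F (take n X) (\<yy> X (n + 1))) z =
      - tri (snd F (take n X) (\<yy> X (n + 1))) (\<xx> X (n + 1)) z"
    by (rule tri_skew)
  ultimately show ?thesis
    unfolding deltaII_def circII_LY_pair_left[OF True] circII_LY_pair_right[OF True]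
    using True
    by (simp add: ad_mu_def ad_D_def scale_right_distrib scale_right_diff_distrib scale_sum_right
        minus_one_power_scale minus sum.distrib sum_negf sum_subtractf
        algebra_simps del: One_nat_def)
qed (simp add: deltaII_def circII_def)

text \<open>In degree \<open>0\<close> the compositions involve no shuffles and the sign
  \<open>(-1) ^ (1 * 0)\<close> is \<open>1\<close>, so unfolding and skew symmetry suffice.\<close>

lemma delta0_eq: "delta0 br tri f = d_LY scale br tri 0 (hom0 f)"
proof -
  have "br (f x) y = - br y (f x)" "tri x (f y) z = - tri (f y) x z" for x y z
    by (rule br_skew, rule tri_skew)
  then show ?thesis
    by (auto simp: delta0_def d_LY_def LieY_bracket_def circ_def circ_right0_def circ_left0_def
        map0_def hom0_def cscale_def LY_pair_def ad_rho_def ad_D_def ad_mu_def Let_def fun_eq_iff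
        length_Suc_conv prod_eq_iff)
qed

end

theorem theorem3p5:
  fixes scale :: "'k::field_char_0 \<Rightarrow> 'g::ab_group_add \<Rightarrow> 'g"
    and br :: "'g \<Rightarrow> 'g \<Rightarrow> 'g"
    and tri :: "'g \<Rightarrow> 'g \<Rightarrow> 'g \<Rightarrow> 'g"
  assumes "lie_yamaguti_algebra scale br tri"
  shows "(\<forall>n\<ge>1. \<forall>F \<in> Cochains scale n.
            yamaguti_delta scale br tri n F = cscale scale ((-1) ^ n) (d_LY scale br tri n F)
          \<and> d_LY scale br tri n F = LieY_bracket scale 1 n (LY_pair br tri) F)
       \<and> (\<forall>f. Vector_Spaces.linear scale scale f \<longrightarrow>
            yamaguti_delta scale br tri 0 (hom0 f) = d_LY scale br tri 0 (hom0 f)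
          \<and> d_LY scale br tri 0 (hom0 f) = LieY_bracket scale 1 0 (LY_pair br tri) (hom0 f))"
proof -
  interpret lie_yamaguti_algebra scale br tri by fact
  have "yamaguti_delta scale br tri n F = cscale scale ((-1) ^ n) (d_LY scale br tri n F)"
    if "n \<ge> 1" for n F
    using that deltaI_eq[OF that] deltaII_eq
    by (simp add: yamaguti_delta_def d_LY_def LieY_bracket_def circ_def cscale_def fun_eq_iff)
  moreover have "yamaguti_delta scale br tri 0 (hom0 f) = d_LY scale br tri 0 (hom0 f)" for f
    using delta0_eq by (simp add: yamaguti_delta_def map0_def hom0_def)
  ultimately show ?thesis by (simp add: d_LY_def)
qed

end
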